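(* There is an algorithm that, given the number $m\ge1$ of homogeneous tasks (all of utility $1$) and the proficiencies $1\ge p_1\ge p_2\ge\dots\ge p_n\ge\tfrac12$ of $n$ workers in sorted order, computes in time $O(n^2m)$ (counting arithmetic operations, comparisons and roundings) an optimal deterministic assignment of tasks to workers for the adversarial task allocation game with budget $m$ in which the attacker observes the actual assignment.
   Context: Setting: there are $n$ workers and a set $T$ of $m$ binary labeling tasks. Worker $w$ labels a task correctly with probability $p_w\in[\tfrac12,1]$, independently across workers and tasks; the proficiencies are known to the defender. Every worker is able to complete all tasks. Each task $t$ has an unknown correct label $\iota_t\in\{0,1\}$. A (deterministic) assignment $s$ specifies for each task $t$ a (possibly empty) set $W_t(s)$ of workers, subject to the budget constraint $\sum_{t}|W_t(s)|\le m$; a task may be given to several workers. The defender aggregates the labels received for a task into one label by a fixed deterministic mapping $\delta$ from label vectors in $\{0,1\}^k$, $k\ge1$, to $\{0,1\}$, with $\delta(l)=l$ when a single label is received. The defender obtains utility $u_t$ (here $u_t=1$) from task $t$ if the aggregated label equals $\iota_t$, and $0$ otherwise (in particular if no label is received). The attacker attacks exactly one worker $a$ after the assignment; the labels of worker $a$ are then lost, so the task is decided by the labels of $W_t(s)\setminus\{a\}$ (zero utility if this set is empty). The defender's utility $u_{def}(s,a)$ is the expected total utility over tasks after attack $a$. The attacker observes $s$ and chooses $a$ to minimize $u_{def}(s,a)$. A deterministic assignment $s$ is optimal if it maximizes $\min_a u_{def}(s,a)$ over all assignments. When each task is given to a single worker and $s_w$ denotes the number of tasks given to worker $w$, this utility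 is $\sum_w s_wp_w-\max_a s_ap_a$. *)

theory Defs
  imports "HOL-Probability.Probability"
begin

section \<open>The adversarial task allocation game\<close>

text \<open>
  Workers are \<open>0, \<dots>, n - 1\<close> and tasks are \<open>0, \<dots>, m - 1\<close>.  An assignment maps a task \<open>t\<close> to the
  set \<open>W\<^sub>t(s)\<close> of its workers.  The number \<open>m\<close> of tasks is also the budget.
\<close>

definition assignment :: "nat \<Rightarrow> nat \<Rightarrow> (nat \<Rightarrow> nat set) \<Rightarrow> bool" where
  "assignment n m s \<longleftrightarrow>
     (\<forall>t<m. s t \<subseteq> {..<n}) \<and> (\<forall>t\<ge>m. s t = {}) \<and> (\<Sum>t<m. card (s t)) \<le> m"

text \<open>
  The label that worker \<open>w\<close> gives (or would give) to task \<open>t\<close> is the coordinate \<open>(w, t)\<close>.  It equals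
  the correct label \<open>\<iota> t\<close> with probability \<open>p w\<close>; coordinates are independent.
\<close>

definition labels_pmf ::
    "nat \<Rightarrow> nat \<Rightarrow> (nat \<Rightarrow> real) \<Rightarrow> (nat \<Rightarrow> bool) \<Rightarrow> (nat \<times> nat \<Rightarrow> bool) pmf" where
  "labels_pmf n m p \<iota> =
     Pi_pmf ({..<n} \<times> {..<m}) False (\<lambda>(w, t). bernoulli_pmf (if \<iota> t then p w else 1 - p w))"

text \<open>
  Label vectors are lists, ordered by worker number.  The aggregation map \<open>\<delta>\<close> is never applied
  to the empty list.
\<close>

definition task_payoff ::
    "(nat \<Rightarrow> real) \<Rightarrow> (bool list \<Rightarrow> bool) \<Rightarrow> (nat \<Rightarrow> bool) \<Rightarrow> (nat \<Rightarrow> nat set) \<Rightarrow> nat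
      \<Rightarrow> (nat \<times> nat \<Rightarrow> bool) \<Rightarrow> nat \<Rightarrow> real" where
  "task_payoff u \<delta> \<iota> s a L t =
     (if s t - {a} \<noteq> {} \<and> \<delta> (map (\<lambda>w. L (w, t)) (sorted_list_of_set (s t - {a}))) = \<iota> t
      then u t else 0)"

definition u_def ::
    "nat \<Rightarrow> nat \<Rightarrow> (nat \<Rightarrow> real) \<Rightarrow> (nat \<Rightarrow> real) \<Rightarrow> (bool list \<Rightarrow> bool) \<Rightarrow> (nat \<Rightarrow> bool)
      \<Rightarrow> (nat \<Rightarrow> nat set) \<Rightarrow> nat \<Rightarrow> real" where
  "u_def n m p u \<delta> \<iota> s a =
     measure_pmf.expectation (labels_pmf n m p \<iota>) (\<lambda>L. \<Sum>t<m. task_payoff u \<delta> \<iota> s a L t)"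

definition attacked_utility ::
    "nat \<Rightarrow> nat \<Rightarrow> (nat \<Rightarrow> real) \<Rightarrow> (nat \<Rightarrow> real) \<Rightarrow> (bool list \<Rightarrow> bool) \<Rightarrow> (nat \<Rightarrow> bool)
      \<Rightarrow> (nat \<Rightarrow> nat set) \<Rightarrow> real" where
  "attacked_utility n m p u \<delta> \<iota> s = Min (u_def n m p u \<delta> \<iota> s ` {..<n})"

definition optimal_assignment ::
    "nat \<Rightarrow> nat \<Rightarrow> (nat \<Rightarrow> real) \<Rightarrow> (nat \<Rightarrow> real) \<Rightarrow> (bool list \<Rightarrow> bool) \<Rightarrow> (nat \<Rightarrow> bool)
      \<Rightarrow> (nat \<Rightarrow> nat set) \<Rightarrow> bool" where
  "optimal_assignment n m p u \<delta> \<iota> s \<longleftrightarrow>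
     is_arg_max (attacked_utility n m p u \<delta> \<iota>) (assignment n m) s"


section \<open>Programs over integers and reals\<close>

text \<open>
  A while language with integer and real variables and arrays.  The only real values a program
  can name are its inputs and what it computes from them and from integers; there are no real
  literals.  Division by zero yields zero, as in HOL.
\<close>

datatype iexp =
    IConst int | IVar nat | IArr nat iexp
  | IAdd iexp iexp | ISub iexp iexp | IMul iexp iexp | Floor rexp
and rexp =
    OfInt iexp | RVar nat | RArr nat iexp
  | RAdd rexp rexp | RSub rexp rexp | RMul rexp rexp | RDiv rexp rexp

datatype bexp =
    IEq iexp iexp | ILess iexp iexp | REq rexp rexp | RLess rexp rexp
  | BNot bexp | BAnd bexp bexp

datatype com =
    SKIP
  | SetI nat iexp | SetR nat rexp
  | StoreI nat iexp iexp \<comment> \<open>array, index, value\<close>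
  | StoreR nat iexp rexp
  | Seq com com | Cond bexp com com | While bexp com

record state =
  ivar :: "nat \<Rightarrow> int"
  rvar :: "nat \<Rightarrow> real"
  iarr :: "nat \<Rightarrow> int \<Rightarrow> int"
  rarr :: "nat \<Rightarrow> int \<Rightarrow> real"

primrec ival :: "iexp \<Rightarrow> state \<Rightarrow> int" and rval :: "rexp \<Rightarrow> state \<Rightarrow> real" where
  "ival (IConst k) \<sigma> = k"
| "ival (IVar x) \<sigma> = ivar \<sigma> x"
| "ival (IArr x e) \<sigma> = iarr \<sigma> x (ival e \<sigma>)"
| "ival (IAdd e f) \<sigma> = ival e \<sigma> + ival f \<sigma>"
| "ival (ISub e f) \<sigma> = ival e \<sigma> - ival f \<sigma>"
| "ival (IMul e f) \<sigma> = ival e \<sigma> * ival f \<sigma>"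
| "ival (Floor r) \<sigma> = \<lfloor>rval r \<sigma>\<rfloor>"
| "rval (OfInt e) \<sigma> = real_of_int (ival e \<sigma>)"
| "rval (RVar x) \<sigma> = rvar \<sigma> x"
| "rval (RArr x e) \<sigma> = rarr \<sigma> x (ival e \<sigma>)"
| "rval (RAdd r q) \<sigma> = rval r \<sigma> + rval q \<sigma>"
| "rval (RSub r q) \<sigma> = rval r \<sigma> - rval q \<sigma>"
| "rval (RMul r q) \<sigma> = rval r \<sigma> * rval q \<sigma>"
| "rval (RDiv r q) \<sigma> = rval r \<sigma> / rval q \<sigma>"

primrec bval :: "bexp \<Rightarrow> state \<Rightarrow> bool" where
  "bval (IEq e f) \<sigma> \<longleftrightarrow> ival e \<sigma> = ival f \<sigma>"
| "bval (ILess e f) \<sigma> \<longleftrightarrow> ival e \<sigma> < ival f \<sigma>"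
| "bval (REq r q) \<sigma> \<longleftrightarrow> rval r \<sigma> = rval q \<sigma>"
| "bval (RLess r q) \<sigma> \<longleftrightarrow> rval r \<sigma> < rval q \<sigma>"
| "bval (BNot b) \<sigma> \<longleftrightarrow> \<not> bval b \<sigma>"
| "bval (BAnd b c) \<sigma> \<longleftrightarrow> bval b \<sigma> \<and> bval c \<sigma>"

text \<open>
  The cost of an expression is its number of arithmetic operations, comparisons and roundings.
  Data movement is free, but since every boolean expression contains a comparison, every
  loop iteration has positive cost; so charging all steps of a program would change
  its running time by at most a constant factor (and an additive constant).
\<close>

primrec icost :: "iexp \<Rightarrow> nat" and rcost :: "rexp \<Rightarrow> nat" where
  "icost (IConst k) = 0"
| "icost (IVar x) = 0"
| "icost (IArr x e) = icost e"
| "icost (IAdd e f) = icost e + icost f + 1"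
| "icost (ISub e f) = icost e + icost f + 1"
| "icost (IMul e f) = icost e + icost f + 1"
| "icost (Floor r) = rcost r + 1"
| "rcost (OfInt e) = icost e"
| "rcost (RVar x) = 0"
| "rcost (RArr x e) = icost e"
| "rcost (RAdd r q) = rcost r + rcost q + 1"
| "rcost (RSub r q) = rcost r + rcost q + 1"
| "rcost (RMul r q) = rcost r + rcost q + 1"
| "rcost (RDiv r q) = rcost r + rcost q + 1"

primrec bcost :: "bexp \<Rightarrow> nat" where
  "bcost (IEq e f) = icost e + icost f + 1"
| "bcost (ILess e f) = icost e + icost f + 1"
| "bcost (REq r q) = rcost r + rcost q + 1"
| "bcost (RLess r q) = rcost r + rcost q + 1"
| "bcost (BNot b) = bcost b"
| "bcost (BAnd b c) = bcost b + bcost c"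

text \<open>\<open>exec c \<sigma> k \<tau>\<close>: started in \<open>\<sigma>\<close>, the program \<open>c\<close> terminates in \<open>\<tau>\<close> at cost \<open>k\<close>.\<close>

inductive exec :: "com \<Rightarrow> state \<Rightarrow> nat \<Rightarrow> state \<Rightarrow> bool" where
  Skip: "exec SKIP \<sigma> 0 \<sigma>"
| SetI: "exec (SetI x e) \<sigma> (icost e) (\<sigma>\<lparr>ivar := (ivar \<sigma>)(x := ival e \<sigma>)\<rparr>)"
| SetR: "exec (SetR x r) \<sigma> (rcost r) (\<sigma>\<lparr>rvar := (rvar \<sigma>)(x := rval r \<sigma>)\<rparr>)"
| StoreI: "exec (StoreI x e f) \<sigma> (icost e + icost f)
    (\<sigma>\<lparr>iarr := (iarr \<sigma>)(x := (iarr \<sigma> x)(ival e \<sigma> := ival f \<sigma>))\<rparr>)"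
| StoreR: "exec (StoreR x e r) \<sigma> (icost e + rcost r)
    (\<sigma>\<lparr>rarr := (rarr \<sigma>)(x := (rarr \<sigma> x)(ival e \<sigma> := rval r \<sigma>))\<rparr>)"
| Seq: "exec c \<sigma> i \<rho> \<Longrightarrow> exec d \<rho> j \<tau> \<Longrightarrow> exec (Seq c d) \<sigma> (i + j) \<tau>"
| CondTrue: "bval b \<sigma> \<Longrightarrow> exec c \<sigma> i \<tau> \<Longrightarrow> exec (Cond b c d) \<sigma> (bcost b + i) \<tau>"
| CondFalse: "\<not> bval b \<sigma> \<Longrightarrow> exec d \<sigma> i \<tau> \<Longrightarrow> exec (Cond b c d) \<sigma> (bcost b + i) \<tau>"
| WhileFalse: "\<not> bval b \<sigma> \<Longrightarrow> exec (While b c) \<sigma> (bcost b) \<sigma>"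
| WhileTrue: "bval b \<sigma> \<Longrightarrow> exec c \<sigma> i \<rho> \<Longrightarrow> exec (While b c) \<rho> j \<tau> \<Longrightarrow>
    exec (While b c) \<sigma> (bcost b + i + j) \<tau>"

inductive_cases exec_elims:
  "exec SKIP \<sigma> k \<tau>" "exec (SetI x e) \<sigma> k \<tau>" "exec (SetR x r) \<sigma> k \<tau>"
  "exec (StoreI x e f) \<sigma> k \<tau>" "exec (StoreR x e r) \<sigma> k \<tau>"
  "exec (Seq c d) \<sigma> k \<tau>" "exec (Cond b c d) \<sigma> k \<tau>"
inductive_cases exec_WhileE: "exec (While b c) \<sigma> k \<tau>"

lemma exec_deterministic:
  "exec c \<sigma> k \<tau> \<Longrightarrow> exec c \<sigma> k' \<tau>' \<Longrightarrow> k = k' \<and> \<tau> = \<tau>'"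
proof (induction arbitrary: k' \<tau>' rule: exec.induct)
  case (Seq c \<sigma> i \<rho> d j \<tau>)
  from Seq.prems obtain i' \<rho>' j' where
    run: "k' = i' + j'" "exec c \<sigma> i' \<rho>'" "exec d \<rho>' j' \<tau>'"
    by (auto elim: exec_elims)
  from Seq.IH(1)[OF run(2)] Seq.IH(2) run show ?case by auto
next
  case (CondTrue b \<sigma> c i \<tau> d)
  from CondTrue.prems CondTrue.hyps(1) obtain i' where
    run: "k' = bcost b + i'" "exec c \<sigma> i' \<tau>'"
    by (auto elim: exec_elims)
  from CondTrue.IH[OF run(2)] run(1) show ?case by simp
next
  case (CondFalse b \<sigma> d i \<tau> c)
  from CondFalse.prems CondFalse.hyps(1) obtain i' where
    run: "k' = bcost b + i'" "exec d \<sigma> i' \<tau>'"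
    by (auto elim: exec_elims)
  from CondFalse.IH[OF run(2)] run(1) show ?case by simp
next
  case (WhileFalse b \<sigma> c)
  then show ?case by (auto elim: exec_WhileE)
next
  case (WhileTrue b \<sigma> c i \<rho> j \<tau>)
  from WhileTrue.prems WhileTrue.hyps(1) obtain i' \<rho>' j' where
    run: "k' = bcost b + i' + j'" "exec c \<sigma> i' \<rho>'" "exec (While b c) \<rho>' j' \<tau>'"
    by (auto elim: exec_WhileE)
  from WhileTrue.IH(1)[OF run(2)] WhileTrue.IH(2) run show ?case by auto
qed (auto elim: exec_elims)


section \<open>Input and output of an allocation program\<close>

text \<open>
  Integer variables 0 and 1 hold \<open>n\<close> and \<open>m\<close>, real array 0 holds the proficiencies; all other memory
  is zero.  The output is a list of (task, worker) pairs: its length is in integer variable 0, its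
  entries are in integer arrays 0 and 1.
\<close>

definition input_state :: "nat \<Rightarrow> nat \<Rightarrow> (nat \<Rightarrow> real) \<Rightarrow> state" where
  "input_state n m p =
     \<lparr>ivar = (\<lambda>_. 0)(0 := int n, 1 := int m),
      rvar = (\<lambda>_. 0),
      iarr = (\<lambda>_ _. 0),
      rarr = (\<lambda>_ _. 0)(0 := (\<lambda>i. if 0 \<le> i \<and> i < int n then p (nat i) else 0))\<rparr>"

definition output_assignment :: "state \<Rightarrow> nat \<Rightarrow> nat set" where
  "output_assignment \<sigma> t =
     {w. \<exists>j. 0 \<le> j \<and> j < ivar \<sigma> 0 \<and> iarr \<sigma> 0 j = int t \<and> iarr \<sigma> 1 j = int w}"

end

theory Submission imports Defs begin

text \<open>
  Since \<open>p\<^sub>w \<ge> 1/2\<close>, sharing tasks never beats single-worker tasks, so the problem is to maximize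
  \<open>\<Sum>\<^sub>w s\<^sub>w p\<^sub>w - max\<^sub>a s\<^sub>a p\<^sub>a\<close> over counts with \<open>\<Sum>\<^sub>w s\<^sub>w \<le> m\<close>.  For a fixed cap \<open>V\<close> on the maximum,
  worker \<open>w\<close> may take up to \<open>\<lfloor>V / p\<^sub>w\<rfloor>\<close> tasks, and filling these quotas from the most proficient worker
  down is optimal.  The maximum of an optimal assignment is \<open>k p\<^sub>a\<close> for some worker \<open>a\<close> and some
  \<open>k \<le> m\<close>, so it suffices to try these \<open>O(n m)\<close> caps at cost \<open>O(n)\<close> each.  Valuing a filling by its sum
  minus \<open>V\<close>, although its maximum may be smaller than \<open>V\<close>, only underestimates it and is still
  at least the optimum when \<open>V\<close> is the maximum of an optimal assignment.
\<close>

section \<open>The game with single-worker tasks\<close>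

definition workload :: "nat \<Rightarrow> (nat \<Rightarrow> nat set) \<Rightarrow> nat \<Rightarrow> nat" where
  "workload m s w = card {t. t < m \<and> w \<in> s t}"

lemma sum_workload:
  fixes f :: "nat \<Rightarrow> real"
  assumes "\<And>t. t < m \<Longrightarrow> s t \<subseteq> {..<n}"
  shows "(\<Sum>t<m. \<Sum>w\<in>s t. f w) = (\<Sum>w<n. real (workload m s w) * f w)"
proof -
  have "(\<Sum>t<m. \<Sum>w\<in>s t. f w) = (\<Sum>t<m. \<Sum>w<n. if w \<in> s t then f w else 0)"
    using assms by (intro sum.cong refl sum.mono_neutral_cong_left) auto
  also have "\<dots> = (\<Sum>w<n. \<Sum>t<m. if w \<in> s t then f w else 0)"
    by (rule sum.swap)
  also have "\<dots> = (\<Sum>w<n. real (workload m s w) * f w)"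
    by (simp add: sum.inter_filter[symmetric] workload_def)
  finally show ?thesis .
qed

lemma sum_workload_minus:
  fixes f :: "nat \<Rightarrow> real"
  assumes "\<And>t. t < m \<Longrightarrow> s t \<subseteq> {..<n}" "a < n"
  shows "(\<Sum>t<m. \<Sum>w\<in>s t - {a}. f w) =
    (\<Sum>w<n. real (workload m s w) * f w) - real (workload m s a) * f a"
proof -
  \<comment> \<open>The assignment left after the attack is again covered by
    \<open>sum_workload\<close>, with the load of \<open>a\<close> set to zero.\<close>
  have eq: "workload m (\<lambda>t. s t - {a}) w = (if w = a then 0 else workload m s w)" for w
    by (simp add: workload_def)
  have "(\<Sum>t<m. \<Sum>w\<in>s t - {a}. f w) =
      (\<Sum>w<n. real (if w = a then 0 else workload m s w) * f w)"
    using assms(1) by (subst sum_workload) (auto simp: eq)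
  also have "\<dots> = (\<Sum>w\<in>{..<n} - {a}. real (workload m s w) * f w)"
    by (rule sum.mono_neutral_cong_right) auto
  finally show ?thesis
    using assms(2) by (simp add: sum_diff1)
qed

section \<open>Expected payoffs of tasks under attack\<close>

lemma expectation_label:
  assumes "w < n" "t < m" "0 \<le> p w" "p w \<le> 1"
  shows "measure_pmf.expectation (labels_pmf n m p \<iota>)
    (\<lambda>L. if L (w, t) = \<iota> t then 1 else 0 :: real) = p w"
proof -
  have marginal: "map_pmf (\<lambda>L. L (w, t)) (labels_pmf n m p \<iota>) =
      bernoulli_pmf (if \<iota> t then p w else 1 - p w)"
    unfolding labels_pmf_def using assms by (subst Pi_pmf_component) auto
  have "measure_pmf.expectation (labels_pmf n m p \<iota>)
      (\<lambda>L. if L (w, t) = \<iota> t then 1 else 0 :: real) =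
    measure_pmf.expectation (map_pmf (\<lambda>L. L (w, t)) (labels_pmf n m p \<iota>))
      (\<lambda>b. if b = \<iota> t then 1 else 0)"
    by (simp only: integral_map_pmf)
  also have "\<dots> = p w"
    unfolding marginal using assms by (cases "\<iota> t") simp_all
  finally show ?thesis .
qed

lemma task_payoff_bounds: "0 \<le> task_payoff (\<lambda>_. 1) \<delta> \<iota> s a L t" "task_payoff (\<lambda>_. 1) \<delta> \<iota> s a L t \<le> 1"
  by (simp_all add: task_payoff_def)

lemma integrable_task_payoff:
  "integrable (measure_pmf M) (\<lambda>L. task_payoff (\<lambda>_. 1) \<delta> \<iota> s a L t)"
  by (rule measure_pmf.integrable_const_bound[where B = 1]) (auto simp: task_payoff_def)

lemma u_def_eq:
  "u_def n m p (\<lambda>_. 1) \<delta> \<iota> s a = (\<Sum>t<m. measure_pmf.expectation (labels_pmf n m p \<iota>)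
     (\<lambda>L. task_payoff (\<lambda>_. 1) \<delta> \<iota> s a L t))"
  unfolding u_def_def by (rule Bochner_Integration.integral_sum) (rule integrable_task_payoff)

lemma expectation_payoff_le_one:
  "measure_pmf.expectation M (\<lambda>L. task_payoff (\<lambda>_. 1) \<delta> \<iota> s a L t) \<le> 1"
proof -
  have "measure_pmf.expectation M (\<lambda>L. task_payoff (\<lambda>_. 1) \<delta> \<iota> s a L t) \<le>
    measure_pmf.expectation M (\<lambda>_. 1)"
    by (intro integral_mono integrable_task_payoff task_payoff_bounds) auto
  then show ?thesis by simp
qed

context
  fixes n m :: nat and p :: "nat \<Rightarrow> real"
  assumes p_bounds: "\<And>w. w < n \<Longrightarrow> 1/2 \<le> p w \<and> p w \<le> 1"
begin

text \<open>With no survivor both sides vanish; a lone survivor's label passes through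
  \<open>\<delta>\<close> unchanged.\<close>

lemma expectation_payoff_single:
  assumes "\<And>l. \<delta> [l] = l" "t < m" "s t \<subseteq> {..<n}" "card (s t - {a}) \<le> 1"
  shows "measure_pmf.expectation (labels_pmf n m p \<iota>) (\<lambda>L. task_payoff (\<lambda>_. 1) \<delta> \<iota> s a L t) =
    (\<Sum>w\<in>s t - {a}. p w)"
proof (cases "s t - {a} = {}")
  case True
  show ?thesis by (simp add: task_payoff_def True)
next
  case False
  moreover have "finite (s t - {a})"
    using assms(3) finite_subset by blast
  ultimately have "card (s t - {a}) = 1"
    using assms(4) by (metis One_nat_def card_0_eq le_SucE le_zero_eq)
  then obtain w where w: "s t - {a} = {w}"
    by (auto simp: card_1_singleton_iff)
  with assms(3) have "w < n" by auto
  with p_bounds[OF this] show ?thesis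
    using assms(1,2) by (simp add: task_payoff_def w expectation_label)
qed

text \<open>
  Splitting a task with \<open>k \<ge> 2\<close> workers into \<open>k\<close> single-worker tasks never hurts, whatever
  \<open>\<delta>\<close> does: two or more surviving workers contribute at least \<open>1/2 + 1/2\<close> when separated and
  at most \<open>1\<close> when sharing one task.
\<close>

lemma expectation_payoff_le:
  assumes "\<And>l. \<delta> [l] = l" "t < m" "s t \<subseteq> {..<n}"
  shows "measure_pmf.expectation (labels_pmf n m p \<iota>) (\<lambda>L. task_payoff (\<lambda>_. 1) \<delta> \<iota> s a L t) \<le>
    (\<Sum>w\<in>s t - {a}. p w)"
proof (cases "card (s t - {a}) \<le> 1")
  case True
  then show ?thesis by (simp add: expectation_payoff_single assms)
next
  case False
  have "1 \<le> (\<Sum>w\<in>s t - {a}. 1/2 :: real)"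
    using False by simp
  also have "\<dots> \<le> (\<Sum>w\<in>s t - {a}. p w)"
    using p_bounds assms(3) by (intro sum_mono) auto
  finally show ?thesis
    using expectation_payoff_le_one by (rule order_trans[rotated])
qed

text \<open>The bound depends on \<open>s\<close> only through its workloads, which reduces
  arbitrary assignments to count vectors. It is attained when no task is shared
  (\<open>u_def_single\<close>).\<close>

lemma u_def_le:
  assumes "\<And>l. \<delta> [l] = l" "\<And>t. t < m \<Longrightarrow> s t \<subseteq> {..<n}" "a < n"
  shows "u_def n m p (\<lambda>_. 1) \<delta> \<iota> s a \<le>
    (\<Sum>w<n. real (workload m s w) * p w) - real (workload m s a) * p a"
proof -
  have "u_def n m p (\<lambda>_. 1) \<delta> \<iota> s a \<le> (\<Sum>t<m. \<Sum>w\<in>s t - {a}. p w)"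
    unfolding u_def_eq using assms by (intro sum_mono expectation_payoff_le) auto
  also have "\<dots> = (\<Sum>w<n. real (workload m s w) * p w) - real (workload m s a) * p a"
    using assms(2,3) by (rule sum_workload_minus)
  finally show ?thesis .
qed

lemma u_def_single:
  assumes "\<And>l. \<delta> [l] = l" "\<And>t. t < m \<Longrightarrow> s t \<subseteq> {..<n}" "a < n"
    and "\<And>t. t < m \<Longrightarrow> card (s t) \<le> 1"
  shows "u_def n m p (\<lambda>_. 1) \<delta> \<iota> s a =
    (\<Sum>w<n. real (workload m s w) * p w) - real (workload m s a) * p a"
proof -
  have "card (s t - {a}) \<le> 1" if "t < m" for t
  proof -
    have "finite (s t)"
      using assms(2)[OF that] finite_subset by blast
    then have "card (s t - {a}) \<le> card (s t)"
      by (simp add: card_mono)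
    with assms(4)[OF that] show ?thesis by simp
  qed
  then have "u_def n m p (\<lambda>_. 1) \<delta> \<iota> s a = (\<Sum>t<m. \<Sum>w\<in>s t - {a}. p w)"
    unfolding u_def_eq using assms by (intro sum.cong refl expectation_payoff_single) auto
  also have "\<dots> = (\<Sum>w<n. real (workload m s w) * p w) - real (workload m s a) * p a"
    using assms(2,3) by (rule sum_workload_minus)
  finally show ?thesis .
qed

end

lemma sum_workload_le:
  assumes "assignment n m s"
  shows "(\<Sum>w<n. workload m s w) \<le> m"
proof -
  have "real (\<Sum>w<n. workload m s w) = (\<Sum>t<m. \<Sum>w\<in>s t. 1)"
    using assms sum_workload[of m s n "\<lambda>_. 1"] by (simp add: assignment_def)
  also have "\<dots> = real (\<Sum>t<m. card (s t))"
    by simp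
  finally show ?thesis
    using assms by (simp only: of_nat_eq_iff assignment_def)
qed


section \<open>Greedy filling\<close>

text \<open>
  The number of tasks that the first \<open>w\<close> workers get when each worker \<open>i\<close> in turn receives
  as many tasks as possible subject to \<open>s\<^sub>i p\<^sub>i \<le> V\<close>.
\<close>

definition fill :: "nat \<Rightarrow> (nat \<Rightarrow> real) \<Rightarrow> real \<Rightarrow> nat \<Rightarrow> int" where
  "fill m p V w = min (int m) (\<Sum>i<w. \<lfloor>V / p i\<rfloor>)"

definition score :: "nat \<Rightarrow> nat \<Rightarrow> (nat \<Rightarrow> real) \<Rightarrow> real \<Rightarrow> real" where
  "score n m p V = (\<Sum>w<n. real_of_int (fill m p V (Suc w) - fill m p V w) * p w) - V"

lemma fill_0 [simp]: "fill m p V 0 = 0"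
  by (simp add: fill_def)

lemma fill_le: "fill m p V w \<le> int m"
  by (simp add: fill_def)

context
  fixes n m :: nat and p :: "nat \<Rightarrow> real"
  assumes p_pos: "\<And>w. w < n \<Longrightarrow> 0 < p w"
begin

text \<open>The quotas are nonnegative, so truncating at \<open>m\<close> after every worker agrees
  with truncating once at the end. The program computes this recurrence.\<close>

lemma fill_Suc:
  assumes "0 \<le> V" "w < n"
  shows "fill m p V (Suc w) = min (int m) (fill m p V w + \<lfloor>V / p w\<rfloor>)"
proof -
  have "0 \<le> \<lfloor>V / p w\<rfloor>"
    using assms p_pos[of w] by simp
  then show ?thesis by (simp add: fill_def min_def del: zero_le_floor)
qed

lemma fill_Suc_le:
  assumes "0 \<le> V" "w < n"
  shows "fill m p V w \<le> fill m p V (Suc w)"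
proof -
  have "0 \<le> \<lfloor>V / p w\<rfloor>"
    using assms p_pos[of w] by simp
  then show ?thesis using fill_le[of m p V w] by (simp add: fill_Suc assms)
qed

lemma fill_mono:
  assumes "0 \<le> V"
  shows "w \<le> n \<Longrightarrow> i \<le> w \<Longrightarrow> fill m p V i \<le> fill m p V w"
proof (induction w)
  case (Suc w)
  then show ?case
    using fill_Suc_le[OF assms, of w] by (cases "i = Suc w") auto
qed simp

lemma fill_nonneg:
  assumes "0 \<le> V" "w \<le> n"
  shows "0 \<le> fill m p V w"
  using fill_mono[OF assms, of 0] by simp

text \<open>An attack on a filling with cap \<open>V\<close> destroys at most \<open>V\<close>;
  hence \<open>score\<close> is a lower bound for its attacked utility.\<close>

lemma fill_share_le:
  assumes "0 \<le> V" "w < n"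
  shows "real_of_int (fill m p V (Suc w) - fill m p V w) * p w \<le> V"
proof -
  have "fill m p V (Suc w) - fill m p V w \<le> \<lfloor>V / p w\<rfloor>"
    using assms by (simp add: fill_Suc)
  then have "real_of_int (fill m p V (Suc w) - fill m p V w) \<le> V / p w"
    by linarith
  then show ?thesis
    using p_pos[OF assms(2)] by (simp add: pos_le_divide_eq)
qed

text \<open>The cap 0 is the initial best cap of the search and stands for the candidates with
  \<open>k = 0\<close>, which the loops do not try.\<close>

lemma score_0: "score n m p 0 = 0"
  by (simp add: score_def fill_def)

text \<open>Respecting the cap means \<open>c j \<le> \<lfloor>V / p j\<rfloor>\<close>, so prefix
  sums grow no faster than the recurrence for \<open>fill\<close> until the latter reaches
  \<open>m\<close>.\<close>

lemma fill_dominates: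
  assumes V: "0 \<le> V" and cap: "\<And>w. w < n \<Longrightarrow> real (c w) * p w \<le> V"
    and total: "(\<Sum>w<n. c w) \<le> m" and "j \<le> n"
  shows "(\<Sum>w<j. int (c w)) \<le> fill m p V j"
  using \<open>j \<le> n\<close>
proof (induction j)
  case (Suc j)
  then have j: "j < n" by simp
  have "real (c j) \<le> V / p j"
    using cap[OF j] p_pos[OF j] by (simp add: pos_le_divide_eq)
  then have "int (c j) \<le> \<lfloor>V / p j\<rfloor>"
    by (simp add: le_floor_iff)
  moreover have "(\<Sum>w<Suc j. c w) \<le> (\<Sum>w<n. c w)"
    using Suc.prems by (intro sum_mono2) auto
  then have "(\<Sum>w<Suc j. int (c w)) \<le> int m"
    using total by (simp flip: of_nat_sum of_nat_add)
  ultimately show ?case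
    using Suc j by (simp add: fill_Suc V)
qed simp

text \<open>The greedy shares dominate in every prefix sum, and decreasing nonnegative weights turn
  this into dominance of the weighted sums.\<close>

lemma greedy_optimal:
  assumes sorted: "\<And>i j. i \<le> j \<Longrightarrow> j < n \<Longrightarrow> p j \<le> p i"
    and V: "0 \<le> V" and cap: "\<And>w. w < n \<Longrightarrow> real (c w) * p w \<le> V"
    and total: "(\<Sum>w<n. c w) \<le> m"
  shows "(\<Sum>w<n. real (c w) * p w) - V \<le> score n m p V"
proof -
  define D where "D j = real_of_int (fill m p V j - (\<Sum>w<j. int (c w)))" for j
  have D: "0 \<le> D j" if "j \<le> n" for j
    using fill_dominates[OF V cap total that] by (simp only: D_def of_int_0_le_iff diff_ge_0_iff_ge)
  \<comment> \<open>summation by parts against the decreasing sequence \<open>p\<close>\<close>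
  have parts: "D j * p (j - 1) \<le>
      (\<Sum>w<j. real_of_int (fill m p V (Suc w) - fill m p V w) * p w) - (\<Sum>w<j. real (c w) * p w)"
    if "j \<le> n" for j
    using that
  proof (induction j)
    case (Suc j)
    \<comment> \<open>The lead \<open>D j\<close> is nonnegative, so replacing its weight by the
      smaller \<open>p j\<close> lowers the left side. For \<open>j = 0\<close> both indices are
      0.\<close>
    have "D j * p j \<le> D j * p (j - 1)"
      using Suc.prems by (intro mult_left_mono sorted D) auto
    moreover have "D (Suc j) = D j + real_of_int (fill m p V (Suc j) - fill m p V j) - real (c j)"
      by (simp add: D_def)
    then have "D (Suc j) * p j = D j * p j +
        real_of_int (fill m p V (Suc j) - fill m p V j) * p j - real (c j) * p j"
      by (simp only: distrib_right left_diff_distrib)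
    ultimately show ?case
      using Suc by simp
  qed (simp add: D_def)
  have "0 \<le> D n * p (n - 1)" if "n \<noteq> 0"
    using that D[of n] p_pos[of "n - 1"] by (intro mult_nonneg_nonneg) auto
  then have "0 \<le> (\<Sum>w<n. real_of_int (fill m p V (Suc w) - fill m p V w) * p w) -
      (\<Sum>w<n. real (c w) * p w)"
    using parts[of n] by (cases "n = 0") (auto intro: order_trans)
  then show ?thesis by (simp add: score_def)
qed

end

text \<open>The chain is: rival utility \<le> score at the rival's own maximum \<le> score at
  \<open>V\<close> \<le> utility of \<open>s\<close>. Worker \<open>w\<close> gets the interval of
  tasks between consecutive values of \<open>fill\<close>, so no task is shared and
  \<open>u_def_single\<close> applies.\<close>

lemma optimal_assignmentI:
  assumes n: "1 \<le> n"
    and p: "\<And>w. w < n \<Longrightarrow> 1/2 \<le> p w \<and> p w \<le> 1"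
    and sorted: "\<And>i j. i \<le> j \<Longrightarrow> j < n \<Longrightarrow> p j \<le> p i"
    and V: "0 \<le> V"
    and best: "\<And>a k. a < n \<Longrightarrow> k \<le> m \<Longrightarrow> score n m p (real k * p a) \<le> score n m p V"
    and s: "\<And>t w. w \<in> s t \<longleftrightarrow> w < n \<and> fill m p V w \<le> int t \<and> int t < fill m p V (Suc w)"
    and \<delta>: "\<And>l. \<delta> [l] = l"
  shows "optimal_assignment n m p (\<lambda>_. 1) \<delta> \<iota> s"
proof -
  have pos: "0 < p w" if "w < n" for w
    using p[OF that] by simp
  have sub: "s t \<subseteq> {..<n}" for t
    using s by auto
  have empty: "s t = {}" if "m \<le> t" for t
  proof -
    have "t < m" if "w \<in> s t" for w
      using s[of w t] that fill_le[of m p V "Suc w"] by linarith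
    with that show ?thesis by fastforce
  qed
  have uniq: "w \<le> w'" if "w \<in> s t" "w' \<in> s t" for t w w'
  proof (rule ccontr)
    assume "\<not> w \<le> w'"
    with that s have "fill m p V (Suc w') \<le> fill m p V w"
      by (intro fill_mono[OF pos V]) auto
    with that s show False by force
  qed
  have single: "card (s t) \<le> 1" for t
  proof -
    have "finite (s t)" using sub finite_subset by blast
    then show ?thesis
      using uniq by (auto simp: card_le_Suc0_iff_eq intro!: antisym)
  qed
  have load: "real (workload m s w) = real_of_int (fill m p V (Suc w) - fill m p V w)"
    if "w < n" for w
  proof -
    have 1: "0 \<le> fill m p V w"
      using fill_nonneg[OF pos V] that by simp
    have 2: "fill m p V w \<le> fill m p V (Suc w)"
      using fill_Suc_le[OF pos V] that by simp
    \<comment> \<open>Since \<open>fill\<close> never exceeds \<open>m\<close>, the restriction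
      \<open>t < m\<close> cuts nothing off the interval.\<close>
    have "{t. t < m \<and> w \<in> s t} = {nat (fill m p V w)..<nat (fill m p V (Suc w))}"
      using that 1 2 fill_le[of m p V "Suc w"] s by auto
    then show ?thesis
      using 1 2 by (simp add: workload_def)
  qed
  have "assignment n m s"
    unfolding assignment_def
  proof (intro conjI allI impI)
    show "(\<Sum>t<m. card (s t)) \<le> m"
      using sum_bounded_above[of "{..<m}" "\<lambda>t. card (s t)" 1] single by simp
  qed (use sub empty in auto)
  moreover have "attacked_utility n m p (\<lambda>_. 1) \<delta> \<iota> y \<le> attacked_utility n m p (\<lambda>_. 1) \<delta> \<iota> s"
    if y: "assignment n m y" for y
  proof -
    define c where "c = workload m y"
    have total: "(\<Sum>w<n. c w) \<le> m"
      using sum_workload_le[OF y] by (simp add: c_def)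
    \<comment> \<open>The rival's largest product is both the attack used against it and the cap for
      the greedy comparison; \<open>c a \<le> m\<close> makes it a candidate in
      \<open>best\<close>.\<close>
    have "Max ((\<lambda>w. real (c w) * p w) ` {..<n}) \<in> (\<lambda>w. real (c w) * p w) ` {..<n}"
      using n by (intro Max_in) (auto simp: lessThan_empty_iff)
    then obtain a where a: "a < n" "Max ((\<lambda>w. real (c w) * p w) ` {..<n}) = real (c a) * p a"
      by auto
    have cap: "real (c w) * p w \<le> real (c a) * p a" if "w < n" for w
      unfolding a(2)[symmetric] using that by (intro Max_ge) auto
    have "c a \<le> (\<Sum>w<n. c w)"
      using a(1) by (intro member_le_sum) auto
    with total have "c a \<le> m" by simp
    have "attacked_utility n m p (\<lambda>_. 1) \<delta> \<iota> y \<le> u_def n m p (\<lambda>_. 1) \<delta> \<iota> y a"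
      unfolding attacked_utility_def using a(1) by (intro Min_le) auto
    also have "\<dots> \<le> (\<Sum>w<n. real (c w) * p w) - real (c a) * p a"
      unfolding c_def using y a(1) by (intro u_def_le[OF p \<delta>]) (auto simp: assignment_def)
    also have "\<dots> \<le> score n m p (real (c a) * p a)"
      using pos[OF a(1)] by (intro greedy_optimal[OF pos sorted _ cap total]) auto
    also have "\<dots> \<le> score n m p V"
      using a(1) \<open>c a \<le> m\<close> by (rule best)
    also have "\<dots> \<le> attacked_utility n m p (\<lambda>_. 1) \<delta> \<iota> s"
      unfolding attacked_utility_def
    proof (rule Min.boundedI)
      fix x assume "x \<in> u_def n m p (\<lambda>_. 1) \<delta> \<iota> s ` {..<n}"
      then obtain b where b: "b < n" "x = u_def n m p (\<lambda>_. 1) \<delta> \<iota> s b"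
        by auto
      have "x = (\<Sum>w<n. real (workload m s w) * p w) - real (workload m s b) * p b"
        unfolding b(2) using b(1) by (intro u_def_single[OF p \<delta>]) (use sub single in auto)
      moreover have "real_of_int (fill m p V (Suc b) - fill m p V b) * p b \<le> V"
        by (rule fill_share_le[OF pos V b(1)])
      ultimately show "score n m p V \<le> x"
        using b(1) by (simp add: score_def load)
    qed (use n in \<open>auto simp: lessThan_empty_iff\<close>)
    finally show ?thesis .
  qed
  ultimately show ?thesis
    by (auto simp: optimal_assignment_def is_arg_max_def not_less)
qed


section \<open>Weakest preconditions with cost\<close>

text \<open>Existential, so that termination is included; by determinism of \<open>exec\<close> the
  run is the only one.\<close>

definition wp :: "com \<Rightarrow> state \<Rightarrow> (nat \<Rightarrow> state \<Rightarrow> bool) \<Rightarrow> bool" where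
  "wp c \<sigma> Q \<longleftrightarrow> (\<exists>k \<tau>. exec c \<sigma> k \<tau> \<and> Q k \<tau>)"

lemma wp_mono: "wp c \<sigma> Q \<Longrightarrow> (\<And>k \<tau>. Q k \<tau> \<Longrightarrow> R k \<tau>) \<Longrightarrow> wp c \<sigma> R"
  unfolding wp_def by blast

text \<open>As equations these let the simplifier run straight-line code symbolically, accumulating
  cost in the postcondition.\<close>

lemma wp_simps [simp]:
  "wp SKIP \<sigma> Q \<longleftrightarrow> Q 0 \<sigma>"
  "wp (SetI x e) \<sigma> Q \<longleftrightarrow> Q (icost e) (\<sigma>\<lparr>ivar := (ivar \<sigma>)(x := ival e \<sigma>)\<rparr>)"
  "wp (SetR x r) \<sigma> Q \<longleftrightarrow> Q (rcost r) (\<sigma>\<lparr>rvar := (rvar \<sigma>)(x := rval r \<sigma>)\<rparr>)"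
  "wp (StoreI x e f) \<sigma> Q \<longleftrightarrow> Q (icost e + icost f)
    (\<sigma>\<lparr>iarr := (iarr \<sigma>)(x := (iarr \<sigma> x)(ival e \<sigma> := ival f \<sigma>))\<rparr>)"
  "wp (Seq c d) \<sigma> Q \<longleftrightarrow> wp c \<sigma> (\<lambda>i \<rho>. wp d \<rho> (\<lambda>j. Q (i + j)))"
  "wp (Cond b c d) \<sigma> Q \<longleftrightarrow> wp (if bval b \<sigma> then c else d) \<sigma> (\<lambda>i. Q (bcost b + i))"
  unfolding wp_def by (auto elim!: exec_elims intro: exec.intros split: if_splits)

text \<open>The number \<open>N\<close> of rounds is known in advance, so the index in
  \<open>P\<close> serves as variant and as cost counter. The last summand pays for the failing
  test.\<close>

lemma wp_While:
  assumes step: "\<And>i \<sigma>. i < N \<Longrightarrow> P i \<sigma> \<Longrightarrow> bval b \<sigma> \<and> wp c \<sigma> (\<lambda>k \<tau>. k \<le> K \<and> P (Suc i) \<tau>)"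
    and exit: "\<And>\<sigma>. P N \<sigma> \<Longrightarrow> \<not> bval b \<sigma>"
    and init: "P 0 \<sigma>"
  shows "wp (While b c) \<sigma> (\<lambda>k \<tau>. k \<le> N * (bcost b + K) + bcost b \<and> P N \<tau>)"
proof -
  have "wp (While b c) \<sigma> (\<lambda>k \<tau>. k \<le> (N - i) * (bcost b + K) + bcost b \<and> P N \<tau>)"
    if "i \<le> N" "P i \<sigma>" for i \<sigma>
    using that
  proof (induction i arbitrary: \<sigma> rule: inc_induct)
    case base
    then show ?case using exit WhileFalse unfolding wp_def by fastforce
  next
    case (step i)
    from assms(1)[OF step.hyps(2) step.prems] obtain k \<rho> where
      b: "bval b \<sigma>" and c: "exec c \<sigma> k \<rho>" "k \<le> K" "P (Suc i) \<rho>"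
      unfolding wp_def by blast
    from step.IH[OF c(3)] obtain j \<tau> where
      w: "exec (While b c) \<rho> j \<tau>" "j \<le> (N - Suc i) * (bcost b + K) + bcost b" "P N \<tau>"
      unfolding wp_def by blast
    have "N - i = Suc (N - Suc i)"
      using step.hyps by simp
    then have "bcost b + k + j \<le> (N - i) * (bcost b + K) + bcost b"
      using c(2) w(2) by simp
    then show ?case
      using WhileTrue[OF b c(1) w(1)] w(3) unfolding wp_def by blast
  qed
  from this[of 0] init show ?thesis by simp
qed


section \<open>The program\<close>

text \<open>
  Integer variables: 2 = \<open>a\<close>, 3 = \<open>k\<close>, 4 = current worker, 5 = current fill, 6 = next fill.
  Real variables: 0 = \<open>V\<close>, 1 = partial score of \<open>V\<close>, 2 = best score so far, 3 = its \<open>V\<close>.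
\<close>

definition next_fill :: "nat \<Rightarrow> com" where
  "next_fill x = Seq
     (SetI 6 (IAdd (IVar 5) (Floor (RDiv (RVar x) (RArr 0 (IVar 4))))))
     (Cond (ILess (IVar 1) (IVar 6)) (SetI 6 (IVar 1)) SKIP)"

definition score_loop :: com where
  "score_loop = While (ILess (IVar 4) (IVar 0))
     (Seq (next_fill 0)
     (Seq (SetR 1 (RAdd (RVar 1) (RMul (OfInt (ISub (IVar 6) (IVar 5))) (RArr 0 (IVar 4)))))
     (Seq (SetI 5 (IVar 6))
          (SetI 4 (IAdd (IVar 4) (IConst 1))))))"

text \<open>The score accumulates from \<open>- V\<close>, written as a difference because there are
  no real literals. Incrementing first makes \<open>k\<close> run from 1 to
  \<open>m\<close>.\<close>

definition try_candidate :: com where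
  "try_candidate =
     Seq (SetI 3 (IAdd (IVar 3) (IConst 1)))
    (Seq (SetR 0 (RMul (OfInt (IVar 3)) (RArr 0 (IVar 2))))
    (Seq (SetR 1 (RSub (OfInt (IConst 0)) (RVar 0)))
    (Seq (SetI 4 (IConst 0))
    (Seq (SetI 5 (IConst 0))
    (Seq score_loop
         (Cond (RLess (RVar 2) (RVar 1)) (Seq (SetR 2 (RVar 1)) (SetR 3 (RVar 0))) SKIP))))))"

definition search_loop :: com where
  "search_loop = While (ILess (IVar 2) (IVar 0))
     (Seq (SetI 3 (IConst 0))
     (Seq (While (ILess (IVar 3) (IVar 1)) try_candidate)
          (SetI 2 (IAdd (IVar 2) (IConst 1)))))"

text \<open>A task's position in the list equals its number, so integer variable 5 is at once the
  current fill, the next task and the length of the list.\<close>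

definition write_loop :: com where
  "write_loop = While (ILess (IVar 5) (IVar 6))
     (Seq (StoreI 0 (IVar 5) (IVar 5))
     (Seq (StoreI 1 (IVar 5) (IVar 4))
          (SetI 5 (IAdd (IVar 5) (IConst 1)))))"

text \<open>The filling is recomputed from the best cap, so the search has to remember only a cap
  and its score.\<close>

definition output_loop :: com where
  "output_loop = While (ILess (IVar 4) (IVar 0))
     (Seq (next_fill 3)
     (Seq write_loop
          (SetI 4 (IAdd (IVar 4) (IConst 1)))))"

definition allocate :: com where
  "allocate =
     Seq search_loop
    (Seq (SetI 4 (IConst 0))
    (Seq (SetI 5 (IConst 0))
    (Seq output_loop
         (SetI 0 (IVar 5)))))"

section \<open>Loop invariants, correctness and cost\<close>

definition inputs :: "nat \<Rightarrow> nat \<Rightarrow> (nat \<Rightarrow> real) \<Rightarrow> state \<Rightarrow> bool" where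
  "inputs n m p \<sigma> \<longleftrightarrow> ivar \<sigma> 0 = int n \<and> ivar \<sigma> 1 = int m \<and> (\<forall>i<n. rarr \<sigma> 0 (int i) = p i)"

lemma inputs_update [simp]:
  "f 0 = ivar \<sigma> 0 \<Longrightarrow> f 1 = ivar \<sigma> 1 \<Longrightarrow> inputs n m p (\<sigma>\<lparr>ivar := f\<rparr>) = inputs n m p \<sigma>"
  "inputs n m p (\<sigma>\<lparr>rvar := h\<rparr>) = inputs n m p \<sigma>"
  "inputs n m p (\<sigma>\<lparr>iarr := g\<rparr>) = inputs n m p \<sigma>"
  by (simp_all add: inputs_def)

text \<open>Only entries below \<open>j\<close> are constrained, so writing entry \<open>j\<close>
  preserves the invariant.\<close>

definition owners :: "nat \<Rightarrow> nat \<Rightarrow> (nat \<Rightarrow> real) \<Rightarrow> real \<Rightarrow> int \<Rightarrow> state \<Rightarrow> bool" where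
  "owners n m p V j \<sigma> \<longleftrightarrow> (\<forall>t. 0 \<le> t \<and> t < j \<longrightarrow> iarr \<sigma> 0 t = t \<and>
     (\<exists>w<n. iarr \<sigma> 1 t = int w \<and> fill m p V w \<le> t \<and> t < fill m p V (Suc w)))"

context
  fixes n m :: nat and p :: "nat \<Rightarrow> real"
  assumes p_pos: "\<And>w. w < n \<Longrightarrow> 0 < p w"
begin

lemma wp_next_fill:
  assumes "inputs n m p \<sigma>" "ivar \<sigma> 4 = int w" "w < n" "rvar \<sigma> x = V" "0 \<le> V"
    and "ivar \<sigma> 5 = fill m p V w"
    and "\<And>k. k \<le> 4 \<Longrightarrow> Q k (\<sigma>\<lparr>ivar := (ivar \<sigma>)(6 := fill m p V (Suc w))\<rparr>)"
  shows "wp (next_fill x) \<sigma> Q"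
proof -
  have "fill m p V (Suc w) =
      (if int m < fill m p V w + \<lfloor>V / p w\<rfloor> then int m else fill m p V w + \<lfloor>V / p w\<rfloor>)"
    using fill_Suc[OF p_pos assms(5,3)] by simp
  then show ?thesis
    using assms by (auto simp: next_fill_def inputs_def)
qed

lemma wp_score_loop:
  assumes "inputs n m p \<sigma>" "ivar \<sigma> 4 = 0" "ivar \<sigma> 5 = 0" "rvar \<sigma> 0 = V" "0 \<le> V" "rvar \<sigma> 1 = - V"
  shows "wp score_loop \<sigma> (\<lambda>k \<tau>. k \<le> 9 * n + 1 \<and> inputs n m p \<tau> \<and> rvar \<tau> 1 = score n m p V \<and>
    (\<forall>x\<in>{2, 3}. ivar \<tau> x = ivar \<sigma> x) \<and> (\<forall>x\<in>{0, 2, 3}. rvar \<tau> x = rvar \<sigma> x))"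
proof -
  define P where "P i \<tau> \<longleftrightarrow> inputs n m p \<tau> \<and> ivar \<tau> 4 = int i \<and> ivar \<tau> 5 = fill m p V i \<and>
    rvar \<tau> 1 = (\<Sum>w<i. real_of_int (fill m p V (Suc w) - fill m p V w) * p w) - V \<and>
    (\<forall>x\<in>{2, 3}. ivar \<tau> x = ivar \<sigma> x) \<and> (\<forall>x\<in>{0, 2, 3}. rvar \<tau> x = rvar \<sigma> x)" for i \<tau>
  show ?thesis
    unfolding score_loop_def
  \<comment> \<open>Of the 8 operations, 4 belong to \<open>next_fill\<close>, 3 to the score update
    and 1 to the counter; the test makes it 9 per round.\<close>
  proof (rule wp_mono[OF wp_While[where P = P and N = n and K = 8]], goal_cases)
    case (1 i \<tau>)
    then have P: "inputs n m p \<tau>" "ivar \<tau> 4 = int i" "rvar \<tau> 0 = V" "ivar \<tau> 5 = fill m p V i"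
      using assms(4) by (auto simp: P_def)
    then have "rarr \<tau> 0 (int i) = p i" "ivar \<tau> 0 = int n"
      using 1(1) by (auto simp: inputs_def)
    then show ?case
      using 1 P by (auto intro!: wp_next_fill[OF P(1,2) 1(1) P(3) assms(5) P(4)] simp: P_def)
  qed (use assms in \<open>auto simp: P_def inputs_def score_def\<close>)
qed

lemma wp_try_candidate:
  assumes "inputs n m p \<sigma>" "ivar \<sigma> 2 = int a" "ivar \<sigma> 3 = int k" "a < n"
    and best: "rvar \<sigma> 2 = score n m p (rvar \<sigma> 3)" "0 \<le> rvar \<sigma> 3"
  shows "wp try_candidate \<sigma> (\<lambda>i \<tau>. i \<le> 9 * n + 5 \<and> inputs n m p \<tau> \<and>
    ivar \<tau> 2 = int a \<and> ivar \<tau> 3 = int (Suc k) \<and>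
    rvar \<tau> 2 = score n m p (rvar \<tau> 3) \<and> 0 \<le> rvar \<tau> 3 \<and>
    rvar \<sigma> 2 \<le> rvar \<tau> 2 \<and> score n m p (real (Suc k) * p a) \<le> rvar \<tau> 2)"
proof -
  have pa: "rarr \<sigma> 0 (int a) = p a"
    using assms by (simp add: inputs_def)
  have V: "0 \<le> real (Suc k) * p a"
    using p_pos[OF assms(4)] by simp
  show ?thesis
    unfolding try_candidate_def
    apply (simp add: assms pa)
    apply (rule wp_mono[OF wp_score_loop[where V = "real (Suc k) * p a"]])
    using assms V by (auto simp: add.commute)
qed

lemma wp_search_loop:
  assumes "inputs n m p \<sigma>" "ivar \<sigma> 2 = 0" "rvar \<sigma> 2 = 0" "rvar \<sigma> 3 = 0"
  shows "wp search_loop \<sigma> (\<lambda>i \<tau>. i \<le> n * (m * (9 * n + 6) + 3) + 1 \<and> inputs n m p \<tau> \<and>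
    0 \<le> rvar \<tau> 3 \<and> (\<forall>a<n. \<forall>k\<le>m. score n m p (real k * p a) \<le> score n m p (rvar \<tau> 3)))"
proof -
  \<comment> \<open>\<open>P a\<close> covers the candidates of all workers before \<open>a\<close>;
    \<open>R a k\<close> adds those of \<open>a\<close> with factor at most \<open>k\<close>. The
    conjunct \<open>0 \<le> rvar \<tau> 2\<close> gives \<open>R a 0\<close>, as the cap 0 scores
    0.\<close>
  define P where "P a \<tau> \<longleftrightarrow> inputs n m p \<tau> \<and> ivar \<tau> 2 = int a \<and>
    rvar \<tau> 2 = score n m p (rvar \<tau> 3) \<and> 0 \<le> rvar \<tau> 3 \<and> 0 \<le> rvar \<tau> 2 \<and>
    (\<forall>b<a. \<forall>k\<le>m. score n m p (real k * p b) \<le> rvar \<tau> 2)" for a \<tau>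
  define R where "R a k \<tau> \<longleftrightarrow> P a \<tau> \<and> ivar \<tau> 3 = int k \<and>
    (\<forall>j\<le>k. score n m p (real j * p a) \<le> rvar \<tau> 2)" for a k \<tau>
  have inner: "wp (While (ILess (IVar 3) (IVar 1)) try_candidate) \<tau>
      (\<lambda>i \<tau>. i \<le> m * (9 * n + 6) + 1 \<and> R a m \<tau>)"
    if "a < n" "R a 0 \<tau>" for a \<tau>
  proof (rule wp_mono[OF wp_While[where P = "R a" and N = m and K = "9 * n + 5"]], goal_cases)
    case (1 k \<rho>)
    then have *: "inputs n m p \<rho>" "ivar \<rho> 2 = int a" "ivar \<rho> 3 = int k"
      "rvar \<rho> 2 = score n m p (rvar \<rho> 3)" "0 \<le> rvar \<rho> 3"
      by (auto simp: R_def P_def)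
    have "wp try_candidate \<rho> (\<lambda>i \<tau>. i \<le> 9 * n + 5 \<and> R a (Suc k) \<tau>)"
    proof (rule wp_mono[OF wp_try_candidate[OF *(1-3) that(1) *(4-5)]], elim conjE, intro conjI)
      fix i \<tau>
      assume \<tau>: "inputs n m p \<tau>" "ivar \<tau> 2 = int a" "ivar \<tau> 3 = int (Suc k)"
        "rvar \<tau> 2 = score n m p (rvar \<tau> 3)" "0 \<le> rvar \<tau> 3"
        and le: "rvar \<rho> 2 \<le> rvar \<tau> 2" "score n m p (real (Suc k) * p a) \<le> rvar \<tau> 2"
      have "x \<le> rvar \<tau> 2" if "x \<le> rvar \<rho> 2" for x
        using that le(1) by simp
      with 1(2) \<tau> le(2) show "R a (Suc k) \<tau>"
        unfolding R_def P_def by (metis le_Suc_eq)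
    qed
    with 1 * show ?case by (simp add: inputs_def)
  qed (use that in \<open>auto simp: R_def P_def inputs_def algebra_simps\<close>)
  have R0: "R a 0 (\<tau>\<lparr>ivar := (ivar \<tau>)(3 := 0)\<rparr>)" if "P a \<tau>" for a \<tau>
    using that by (auto simp: R_def P_def score_0[OF p_pos])
  show ?thesis
    unfolding search_loop_def
  proof (rule wp_mono[OF wp_While[where P = P and N = n and K = "m * (9 * n + 6) + 2"]], goal_cases)
    case (1 a \<tau>)
    have "R a m \<rho> \<Longrightarrow> P (Suc a) (\<rho>\<lparr>ivar := (ivar \<rho>)(2 := int a + 1)\<rparr>)" for \<rho>
      by (auto simp: R_def P_def less_Suc_eq)
    moreover have "R a m \<rho> \<Longrightarrow> ivar \<rho> 2 = int a" for \<rho>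
      by (auto simp: R_def P_def)
    ultimately have "wp (Seq (SetI 3 (IConst 0))
        (Seq (While (ILess (IVar 3) (IVar 1)) try_candidate) (SetI 2 (IAdd (IVar 2) (IConst 1)))))
        \<tau> (\<lambda>k \<tau>. k \<le> m * (9 * n + 6) + 2 \<and> P (Suc a) \<tau>)"
      by (auto intro!: wp_mono[OF inner[OF 1(1) R0[OF 1(2)]]] simp del: One_nat_def)
    with 1 show ?case
      by (simp add: P_def inputs_def)
  qed (use assms in \<open>auto simp: P_def inputs_def score_0[OF p_pos] algebra_simps\<close>)
qed

lemma wp_write_loop:
  assumes "inputs n m p \<sigma>" "ivar \<sigma> 4 = int w" "w < n" "rvar \<sigma> 3 = V" "0 \<le> V"
    and "ivar \<sigma> 5 = fill m p V w" "ivar \<sigma> 6 = fill m p V (Suc w)"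
    and "owners n m p V (fill m p V w) \<sigma>"
  shows "wp write_loop \<sigma> (\<lambda>k \<tau>. k \<le> 2 * m + 1 \<and> inputs n m p \<tau> \<and> ivar \<tau> 4 = int w \<and>
    rvar \<tau> 3 = V \<and> ivar \<tau> 5 = fill m p V (Suc w) \<and> owners n m p V (fill m p V (Suc w)) \<tau>)"
proof -
  define f where "f = fill m p V w"
  define f' where "f' = fill m p V (Suc w)"
  have f: "0 \<le> f" "f \<le> f'" "f' \<le> int m"
    unfolding f_def f'_def using assms(3)
    by (auto intro: fill_nonneg[OF p_pos assms(5)] fill_Suc_le[OF p_pos assms(5)] fill_le)
  define P where "P i \<tau> \<longleftrightarrow> inputs n m p \<tau> \<and> ivar \<tau> 4 = int w \<and> rvar \<tau> 3 = V \<and>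
    ivar \<tau> 5 = f + int i \<and> ivar \<tau> 6 = f' \<and> owners n m p V (f + int i) \<tau>" for i \<tau>
  show ?thesis
    unfolding write_loop_def
  \<comment> \<open>The number of rounds is the worker's share, bounded crudely by \<open>m\<close>
    for each worker; the resulting product of \<open>n\<close> and \<open>m\<close> fits the
    budget.\<close>
  proof (rule wp_mono[OF wp_While[where P = P and N = "nat (f' - f)" and K = 1]], goal_cases)
    case (1 i \<tau>)
    then have "f + int i < f'" by simp
    with 1 f show ?case
      using assms(3) by (auto simp: P_def owners_def f_def[symmetric] f'_def[symmetric] less_le)
  next
    case (4 k \<tau>)
    then show ?case using f by (auto simp: P_def f'_def)
  qed (use assms f in \<open>auto simp: P_def f_def[symmetric] f'_def[symmetric]\<close>)
qed

lemma wp_output_loop: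
  assumes "inputs n m p \<sigma>" "ivar \<sigma> 4 = 0" "ivar \<sigma> 5 = 0" "rvar \<sigma> 3 = V" "0 \<le> V"
  shows "wp output_loop \<sigma> (\<lambda>k \<tau>. k \<le> n * (2 * m + 7) + 1 \<and>
    ivar \<tau> 5 = fill m p V n \<and> owners n m p V (fill m p V n) \<tau>)"
proof -
  define P where "P w \<tau> \<longleftrightarrow> inputs n m p \<tau> \<and> ivar \<tau> 4 = int w \<and> rvar \<tau> 3 = V \<and>
    ivar \<tau> 5 = fill m p V w \<and> owners n m p V (fill m p V w) \<tau>" for w \<tau>
  show ?thesis
    unfolding output_loop_def
  proof (rule wp_mono[OF wp_While[where P = P and N = n and K = "2 * m + 6"]], goal_cases)
    case (1 w \<tau>)
    then have P: "inputs n m p \<tau>" "ivar \<tau> 4 = int w" "rvar \<tau> 3 = V" "ivar \<tau> 5 = fill m p V w"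
      "owners n m p V (fill m p V w) \<tau>"
      by (auto simp: P_def)
    show ?case
      using 1 P
      by (auto intro!: wp_next_fill[OF P(1,2) 1(1) P(3) assms(5) P(4)]
          wp_mono[OF wp_write_loop[OF _ _ 1(1) _ assms(5)]] simp: P_def owners_def inputs_def)
  qed (use assms in \<open>auto simp: P_def inputs_def owners_def algebra_simps\<close>)
qed

lemma wp_allocate:
  assumes "1 \<le> n" "1 \<le> m"
  shows "wp allocate (input_state n m p) (\<lambda>k \<tau>. k \<le> 29 * (n\<^sup>2 * m) \<and> (\<exists>V\<ge>0.
    (\<forall>a<n. \<forall>k\<le>m. score n m p (real k * p a) \<le> score n m p V) \<and>
    ivar \<tau> 0 = fill m p V n \<and> owners n m p V (fill m p V n) \<tau>))"
proof -
  \<comment> \<open>29 = 9 + 8 + 10 + 2: as \<open>n\<close> and \<open>m\<close> are positive,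
    every lower-order monomial is at most \<open>n\<^sup>2 * m\<close>.\<close>
  have cost: "n * (m * (9 * n + 6) + 3) + 1 + (n * (2 * m + 7) + 1) \<le> 29 * (n\<^sup>2 * m)"
  proof -
    have "n * m \<le> n\<^sup>2 * m" "n \<le> n * m" "1 \<le> n"
      using assms by (auto simp: power2_eq_square)
    moreover have "n * (m * (9 * n + 6) + 3) + 1 + (n * (2 * m + 7) + 1) =
        9 * (n\<^sup>2 * m) + 8 * (n * m) + 10 * n + 2"
      by (simp add: power2_eq_square algebra_simps)
    ultimately show ?thesis by linarith
  qed
  show ?thesis
    unfolding allocate_def
    apply simp
    apply (rule wp_mono[OF wp_search_loop])
        apply (auto simp: input_state_def inputs_def)[4]
    subgoal for k \<tau>
      apply (rule wp_mono[OF wp_output_loop[where V = "rvar \<tau> 3"]])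
      using cost by (auto simp: owners_def intro!: exI[of _ "rvar \<tau> 3"])
    done
qed

lemma output_assignment_iff:
  assumes "0 \<le> V" "ivar \<tau> 0 = fill m p V n" "owners n m p V (fill m p V n) \<tau>"
  shows "w \<in> output_assignment \<tau> t \<longleftrightarrow>
    w < n \<and> fill m p V w \<le> int t \<and> int t < fill m p V (Suc w)"
proof
  assume "w \<in> output_assignment \<tau> t"
  then show "w < n \<and> fill m p V w \<le> int t \<and> int t < fill m p V (Suc w)"
    using assms(2,3) by (auto simp: output_assignment_def owners_def)
next
  assume w: "w < n \<and> fill m p V w \<le> int t \<and> int t < fill m p V (Suc w)"
  have mono: "fill m p V i \<le> fill m p V j" if "i \<le> j" "j \<le> n" for i j
    using fill_mono[OF p_pos assms(1) that(2,1)] .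
  from w mono[of "Suc w" n] have t: "int t < fill m p V n" by auto
  with assms(3) obtain v where v: "iarr \<tau> 0 (int t) = int t" "v < n" "iarr \<tau> 1 (int t) = int v"
    "fill m p V v \<le> int t" "int t < fill m p V (Suc v)"
    unfolding owners_def by (metis of_nat_0_le_iff)
  \<comment> \<open>The intervals of distinct workers are disjoint, so the stored owner
    \<open>v\<close> is \<open>w\<close>.\<close>
  have "\<not> v < w" "\<not> w < v"
    using mono[of "Suc v" w] mono[of "Suc w" v] v w by auto
  with v t assms(2) show "w \<in> output_assignment \<tau> t"
    by (auto simp: output_assignment_def intro!: exI[of _ "int t"])
qed

end

theorem mainTheorem2:
  "\<exists>(prog :: com) (C :: nat).
     \<forall>(n :: nat) (m :: nat) (p :: nat \<Rightarrow> real).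
       1 \<le> n \<longrightarrow> 1 \<le> m \<longrightarrow>
       (\<forall>i<n. 1/2 \<le> p i \<and> p i \<le> 1) \<longrightarrow>
       (\<forall>i j. i \<le> j \<longrightarrow> j < n \<longrightarrow> p j \<le> p i) \<longrightarrow>
       (\<exists>k \<tau>. exec prog (input_state n m p) k \<tau> \<and>
          k \<le> C * (n\<^sup>2 * m) \<and>
          (\<forall>(\<delta> :: bool list \<Rightarrow> bool) (\<iota> :: nat \<Rightarrow> bool).
             (\<forall>l. \<delta> [l] = l) \<longrightarrow>
             optimal_assignment n m p (\<lambda>_. 1) \<delta> \<iota> (output_assignment \<tau>)))"
proof (rule exI[of _ allocate], rule exI[of _ 29], intro allI impI)
  fix n m :: nat and p :: "nat \<Rightarrow> real"
  assume n: "1 \<le> n" and m: "1 \<le> m" and p: "\<forall>i<n. 1/2 \<le> p i \<and> p i \<le> 1"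
    and sorted: "\<forall>i j. i \<le> j \<longrightarrow> j < n \<longrightarrow> p j \<le> p i"
  have pos: "0 < p w" if "w < n" for w
    using p that by force
  from wp_allocate[of n p, OF pos n m] obtain k \<tau> V where
    run: "exec allocate (input_state n m p) k \<tau>" "k \<le> 29 * (n\<^sup>2 * m)" and V: "0 \<le> V"
    and best: "\<forall>a<n. \<forall>k\<le>m. score n m p (real k * p a) \<le> score n m p V"
    and out: "ivar \<tau> 0 = fill m p V n" "owners n m p V (fill m p V n) \<tau>"
    unfolding wp_def by blast
  \<comment> \<open>The run is fixed before \<open>\<delta>\<close> and \<open>\<iota>\<close>, so
    one output is optimal for all of them.\<close>
  have "optimal_assignment n m p (\<lambda>_. 1) \<delta> \<iota> (output_assignment \<tau>)" if "\<forall>l. \<delta> [l] = l" for \<delta> \<iota>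
    using p sorted best that
    by (intro optimal_assignmentI[OF n _ _ V _ output_assignment_iff[OF pos V out]]) auto
  with run show "\<exists>k \<tau>. exec allocate (input_state n m p) k \<tau> \<and> k \<le> 29 * (n\<^sup>2 * m) \<and>
      (\<forall>\<delta> \<iota>. (\<forall>l. \<delta> [l] = l) \<longrightarrow>
        optimal_assignment n m p (\<lambda>_. 1) \<delta> \<iota> (output_assignment \<tau>))"
    by blast
qed

end
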